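(* The set $$\{f\in C[0,1]: \dim_H f^{-1}(y)=1\text{ for all }y\in(\min f,\max f)\}$$ is non-shy in $C[0,1]$.
   Context: Shyness: for an abelian Polish group $G$, a set $A\subset G$ is shy if there exist a Borel set $B\supset A$ in $G$ and a Borel probability measure $\nu$ on $G$ with $\nu(B+x)=0$ for all $x\in G$; non-shy means not shy. $C[0,1]$ is the Banach space of continuous functions $[0,1]\to\mathbb{R}$ with the maximum norm (an abelian Polish group under addition). $\dim_H$ is Hausdorff dimension. *)

theory Defs
  imports "HOL-Probability.Probability"
begin

typedef unit_interval = "{0..1::real}"
  by (rule exI[of _ 0]) simp

instantiation unit_interval :: metric_space
begin

definition dist_unit_interval :: "unit_interval \<Rightarrow> unit_interval \<Rightarrow> real" where
  "dist_unit_interval x y = dist (Rep_unit_interval x) (Rep_unit_interval y)"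

definition uniformity_unit_interval :: "(unit_interval \<times> unit_interval) filter" where
  "uniformity_unit_interval = (INF e\<in>{0<..}. principal {(x, y). dist x y < e})"

definition open_unit_interval :: "unit_interval set \<Rightarrow> bool" where
  "open_unit_interval U \<longleftrightarrow> (\<forall>x\<in>U. \<forall>\<^sub>F (x', y) in uniformity. x' = x \<longrightarrow> y \<in> U)"

instance
proof
  fix x y z :: unit_interval
  show "dist x y = 0 \<longleftrightarrow> x = y"
    by (simp add: dist_unit_interval_def Rep_unit_interval_inject)
  show "dist x y \<le> dist x z + dist y z"
    unfolding dist_unit_interval_def by (rule dist_triangle2)
qed (simp_all add: uniformity_unit_interval_def open_unit_interval_def)

end

lemma compact_UNIV_unit_interval: "compact (UNIV :: unit_interval set)"
proof -
  have "continuous_on {0..1::real} Abs_unit_interval"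
    unfolding continuous_on_iff
    by (auto simp: dist_unit_interval_def Abs_unit_interval_inverse)
  then have "compact (Abs_unit_interval ` {0..1})"
    by (rule compact_continuous_image) simp
  moreover have "Abs_unit_interval ` {0..1} = UNIV"
    by (rule type_definition.Abs_image[OF type_definition_unit_interval])
  ultimately show ?thesis by simp
qed

text \<open>The norm of bounded continuous functions is the supremum norm; since the domain is
  compact, this is \<open>C[0,1]\<close> with the maximum norm.\<close>

type_synonym C01 = "unit_interval \<Rightarrow>\<^sub>C real"

definition min_val :: "C01 \<Rightarrow> real" where
  "min_val f = (INF x. apply_bcontfun f x)"

definition max_val :: "C01 \<Rightarrow> real" where
  "max_val f = (SUP x. apply_bcontfun f x)"

lemma min_val_attained:
  "min_val f \<in> range (apply_bcontfun f)" "min_val f \<le> apply_bcontfun f x"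
proof -
  have c: "compact (range (apply_bcontfun f))"
    by (intro compact_continuous_image compact_UNIV_unit_interval) simp
  then have b: "bdd_below (range (apply_bcontfun f))"
    by (intro bounded_imp_bdd_below compact_imp_bounded)
  show "min_val f \<in> range (apply_bcontfun f)"
    unfolding min_val_def using c b by (intro closed_contains_Inf compact_imp_closed) auto
  show "min_val f \<le> apply_bcontfun f x"
    unfolding min_val_def using b by (rule cINF_lower) simp
qed

lemma max_val_attained:
  "max_val f \<in> range (apply_bcontfun f)" "apply_bcontfun f x \<le> max_val f"
proof -
  have c: "compact (range (apply_bcontfun f))"
    by (intro compact_continuous_image compact_UNIV_unit_interval) simp
  then have b: "bdd_above (range (apply_bcontfun f))"
    by (intro bounded_imp_bdd_above compact_imp_bounded)
  show "max_val f \<in> range (apply_bcontfun f)"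
    unfolding max_val_def using c b by (intro closed_contains_Sup compact_imp_closed) auto
  show "apply_bcontfun f x \<le> max_val f"
    unfolding max_val_def using b by (intro cSUP_upper) auto
qed

text \<open>\<open>(diam U)\<^sup>s\<close> with the conventions \<open>(diam {})\<^sup>s = 0\<close> and \<open>0\<^sup>0 = 1\<close>
  for nonempty \<open>U\<close>; note that \<open>0 powr 0 = 0\<close>.\<close>

definition diam_powr :: "real \<Rightarrow> 'a::metric_space set \<Rightarrow> ennreal" where
  "diam_powr s U =
     (if U = {} then 0 else if s = 0 then 1 else ennreal (diameter U powr s))"

text \<open>Countable covers are sequences, possibly with empty members. Boundedness is explicit
  because the value of \<^const>\<open>diameter\<close> on unbounded sets is unspecified.\<close>

definition hausdorff_premeasure :: "real \<Rightarrow> real \<Rightarrow> 'a::metric_space set \<Rightarrow> ennreal" where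
  "hausdorff_premeasure s \<delta> A =
     (INF U\<in>{U :: nat \<Rightarrow> 'a set. A \<subseteq> (\<Union>i. U i) \<and> (\<forall>i. bounded (U i) \<and> diameter (U i) \<le> \<delta>)}.
        \<Sum>i. diam_powr s (U i))"

definition hausdorff_measure :: "real \<Rightarrow> 'a::metric_space set \<Rightarrow> ennreal" where
  "hausdorff_measure s A = (SUP \<delta>\<in>{0<..}. hausdorff_premeasure s \<delta> A)"

definition hausdorff_dim :: "'a::metric_space set \<Rightarrow> ennreal" where
  "hausdorff_dim A = (INF s\<in>{s. 0 \<le> s \<and> hausdorff_measure s A = 0}. ennreal s)"

text \<open>Intended for Polish groups. Translates of Borel sets are Borel, so the
  value of \<^const>\<open>emeasure\<close> below is never that of a nonmeasurable set.\<close>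

definition shy :: "'a::topological_ab_group_add set \<Rightarrow> bool" where
  "shy A \<longleftrightarrow> (\<exists>B \<nu>. B \<in> sets borel \<and> A \<subseteq> B \<and> prob_space \<nu> \<and> sets \<nu> = sets borel \<and>
     (\<forall>x. emeasure \<nu> ((\<lambda>b. b + x) ` B) = 0))"

end

theory Submission imports Defs
begin

text \<open>A Borel probability measure on \<open>C[0,1]\<close> gives positive mass to a set \<open>K\<close> of functions with
  a common modulus of continuity, so it suffices to find one \<open>g\<close> with \<open>f + g\<close> in the set for all
  \<open>f \<in> K\<close>. Take \<open>g(x) = (\<Sum>n. 2\<^sup>-\<^sup>n sin (w n x))\<close> with \<open>w n\<close> growing so fast that \<open>f\<close> and the
  first \<open>n\<close> terms barely vary on intervals of length \<open>l n\<close>, a fixed fraction of the \<open>n\<close>-th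
  period. If the \<open>n\<close>-th partial sum of \<open>f + g\<close> stays close to \<open>y\<close> on such an interval, then the
  next partial sum crosses \<open>y\<close> in every period of the next wave inside it, which yields about
  \<open>l n / l (n + 1)\<close> intervals of the next generation up to a constant factor. As
  \<open>l (n + 1) / l n \<longlonglongrightarrow> 0\<close>, the resulting Cantor set inside the level \<open>y\<close> has dimension 1. For
  \<open>min < y < max\<close> the intermediate value theorem provides a first interval at all large \<open>n\<close>.\<close>

subsection \<open>Cantor schemes and covers by small balls\<close>

text \<open>Sorting the points into cells of length \<open>d\<close> counted from \<open>u\<close>
  is injective, since points of \<open>S\<close> lie at least \<open>d\<close> apart.\<close>

lemma card_separated_le:
  fixes S :: "real set"
  assumes "d > 0" "u \<le> v" "S \<subseteq> {u..v}"
    and sep: "\<And>x y. x \<in> S \<Longrightarrow> y \<in> S \<Longrightarrow> x < y \<Longrightarrow> x + d \<le> y"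
  shows "real (card S) \<le> (v - u) / d + 1"
proof -
  define f where "f x = \<lfloor>(x - u) / d\<rfloor>" for x
  have inj: "inj_on f S"
  proof (rule linorder_inj_onI)
    fix x y assume xy: "x < y" "x \<in> S" "y \<in> S"
    have "(x - u) / d + 1 = (x + d - u) / d" using \<open>d > 0\<close> by (simp add: field_simps)
    also have "\<dots> \<le> (y - u) / d" using sep[OF xy(2,3,1)] \<open>d > 0\<close> by (simp add: divide_right_mono)
    finally show "f x \<noteq> f y" unfolding f_def by linarith
  qed linarith
  have "f ` S \<subseteq> {0..\<lfloor>(v - u) / d\<rfloor>}"
  proof
    fix k assume "k \<in> f ` S"
    then obtain x where x: "x \<in> S" "k = f x" by blast
    then have "u \<le> x" "x \<le> v" using assms(3) by auto
    then show "k \<in> {0..\<lfloor>(v - u) / d\<rfloor>}"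
      unfolding x(2) f_def using \<open>d > 0\<close> by (auto intro!: floor_mono divide_right_mono)
  qed
  then have "card (f ` S) \<le> card {0..\<lfloor>(v - u) / d\<rfloor>}" by (intro card_mono) auto
  moreover have "card (f ` S) = card S" using inj by (rule card_image)
  moreover have "real (card {0..\<lfloor>(v - u) / d\<rfloor>}) \<le> (v - u) / d + 1"
    using assms by simp
  ultimately show ?thesis by linarith
qed


text \<open>Both sides equal \<open>x * y powr (s - 1)\<close>. This trades weight at scale
  \<open>x\<close> for a number of pieces at scale \<open>y\<close>.\<close>

lemma ratio_powr:
  fixes x y s :: real
  assumes "x > 0" "y > 0"
  shows "(x / y) powr (1 - s) * x powr s = x / y * y powr s"
proof -
  have "x powr s = (x / y * y) powr s" using assms by simp
  also have "\<dots> = (x / y) powr s * y powr s" by (rule powr_mult)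
  finally have "(x / y) powr (1 - s) * x powr s = (x / y) powr (1 - s) * ((x / y) powr s * y powr s)" by simp
  also have "(x / y) powr (1 - s) * ((x / y) powr s * y powr s)
      = (x / y) powr (1 - s + s) * y powr s"
    unfolding powr_add by simp
  finally show ?thesis using assms by simp
qed

text \<open>\<open>W l a s\<close> is the total weight \<open>r i powr s\<close> of the balls around
  the \<open>c i\<close> that meet \<open>{a..a + l}\<close>. Pigeonhole: a ball meets at most 4
  children, or at most \<open>4 * (r i / l')\<close> of them if \<open>r i \<ge> l'\<close>, so the
  truncated weights summed over \<open>S\<close> are too small for every child to reach
  \<open>l' powr s / 512\<close>. The constants fit because 512 = 4 * 128.\<close>

lemma escape_step:
  fixes c r :: "nat \<Rightarrow> real"
  defines "W \<equiv> \<lambda>l a s. \<Sum>i. if c i \<in> {a - r i..a + l + r i} then r i powr s else 0"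
  assumes s: "0 < s" "s < 1" and r: "\<And>i. r i > 0" and sum: "summable (\<lambda>i. r i powr s)"
    and l: "0 < l'" "l' \<le> l" and small: "(l' / l) powr (1 - s) \<le> 1/512"
    and W: "W l a s < l powr s / 512"
    and S: "finite S" "\<And>b. b \<in> S \<Longrightarrow> a \<le> b \<and> b + l' \<le> a + l"
    and sep: "\<And>x y. x \<in> S \<Longrightarrow> y \<in> S \<Longrightarrow> x < y \<Longrightarrow> x + l' \<le> y"
    and card: "real (card S) \<ge> l / (128 * l')"
  shows "\<exists>b\<in>S. W l' b s < l' powr s / 512"
proof -
  define hit where "hit i l a \<longleftrightarrow> c i \<in> {a - r i..a + l + r i}" for i l a
  have W_eq: "W l a s = (\<Sum>i. if hit i l a then r i powr s else 0)" for l a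
    unfolding W_def hit_def by simp
  \<comment> \<open>A single ball with \<open>r i \<ge> l'\<close> has weight \<open>l' powr s / 512\<close>, so a child whose weight is below
    this bound meets only smaller balls. Averaging over the children provides such a child.\<close>
  define u where "u i = (if r i < l' then r i powr s else l' powr s / 512)" for i
  define V where "V b = (\<Sum>i. if hit i l' b then u i else 0)" for b
  \<comment> \<open>One factor serves both sizes of ball. If \<open>r i < l'\<close>, the count 4 is
    absorbed by \<open>(l / l') powr (1 - s) \<ge> 512\<close>; otherwise the truncation supplies
    the 1/512, and \<open>r i < l\<close> bounds \<open>(r i / l') powr (1 - s)\<close>.\<close>
  define K where "K = 4/512 * (l / l') powr (1 - s)"
  have "l > 0" using l by linarith
  have Kpos: "K > 0" using l by (simp add: K_def)
  have big: "(l / l') powr (1 - s) \<ge> 512"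
  proof -
    have "(l / l') powr (1 - s) = 1 / (l' / l) powr (1 - s)"
      using l \<open>l > 0\<close> by (simp add: powr_divide)
    moreover have "(l' / l) powr (1 - s) > 0" using l \<open>l > 0\<close> by simp
    moreover have "512 * (l' / l) powr (1 - s) \<le> 1" using small by simp
    ultimately show ?thesis by (simp only: pos_le_divide_eq)
  qed
  have r_le: "r i < l" if "hit i l a" for i
  proof -
    have "(if hit i l a then r i powr s else 0) \<le> W l a s" unfolding W_eq
      by (rule order_trans[OF _ sum_le_suminf[of _ "{i}"]])
         (auto intro!: summable_comparison_test'[OF sum])
    then have "r i powr s \<le> W l a s" using that by simp
    with W powr_ge_zero[of l s] have "r i powr s < l powr s" by linarith
    then show ?thesis using s(1) r \<open>l > 0\<close> by (blast intro: powr_less_cancel2)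
  qed
  have u0: "0 \<le> u i" for i by (simp add: u_def)
  have ur: "u i \<le> r i powr s" for i
  proof (cases "r i < l'")
    case False
    then have "l' powr s \<le> r i powr s" using l s by (intro powr_mono2) auto
    then have "l' powr s / 512 \<le> r i powr s" using powr_ge_zero[of l' s] by linarith
    then show ?thesis using False by (simp add: u_def)
  qed (simp add: u_def)
  have sumV: "summable (\<lambda>i. if hit i l' b then u i else 0)" for b
    by (rule summable_comparison_test'[OF sum]) (use u0 ur in auto)
  have mult_le: "(\<Sum>b\<in>S. if hit i l' b then u i else 0) \<le> K * (if hit i l a then r i powr s else 0)" for i
  proof (cases "hit i l a")
    case False
    then have "\<not> hit i l' b" if "b \<in> S" for b
      using S(2)[OF that] by (auto simp: hit_def)
    then show ?thesis using False by simp
  next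
    case True
    have "(\<Sum>b\<in>S. if hit i l' b then u i else 0) = real (card {b\<in>S. hit i l' b}) * u i"
      using S(1) by (simp add: sum.If_cases Int_def)
    \<comment> \<open>A child is hit exactly when its left end lies in a window of length
      \<open>2 * r i + l'\<close>.\<close>
    also have "real (card {b\<in>S. hit i l' b}) \<le> ((c i + r i) - (c i - r i - l')) / l' + 1"
      using l r[of i] sep by (intro card_separated_le) (auto simp: hit_def)
    then have "real (card {b\<in>S. hit i l' b}) * u i \<le> (2 * r i / l' + 2) * u i"
      using l u0 by (intro mult_right_mono) (auto simp: field_simps)
    also have "\<dots> \<le> K * r i powr s"
    proof (cases "r i < l'")
      case True
      then have "2 * r i / l' + 2 \<le> 4" using l by (simp add: field_simps)
      then have "(2 * r i / l' + 2) * u i \<le> 4 * u i" using u0 by (rule mult_right_mono)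
      also have "\<dots> \<le> K * r i powr s"
        unfolding K_def u_def using big True by (simp add: mult_right_mono)
      finally show ?thesis .
    next
      case False
      then have "2 * r i / l' + 2 \<le> 4 * (r i / l')" using l by (simp add: field_simps)
      then have "(2 * r i / l' + 2) * u i \<le> 4 * (r i / l') * u i" using u0 by (rule mult_right_mono)
      also have "\<dots> = 4/512 * ((r i / l') * l' powr s)" using False by (simp add: u_def)
      also have "(r i / l') * l' powr s = (r i / l') powr (1 - s) * r i powr s"
        using l r[of i] by (simp add: ratio_powr)
      also have "4/512 * ((r i / l') powr (1 - s) * r i powr s)
          \<le> 4/512 * ((l / l') powr (1 - s) * r i powr s)"
        using s l r[of i] r_le[OF \<open>hit i l a\<close>]
        by (intro mult_left_mono mult_right_mono powr_mono2 divide_right_mono) auto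
      also have "\<dots> = K * r i powr s" by (simp add: K_def)
      finally show ?thesis .
    qed
    finally show ?thesis using True by simp
  qed
  have sumW: "summable (\<lambda>i. if hit i l a then r i powr s else 0)"
    by (rule summable_comparison_test'[OF sum]) auto
  have "(\<Sum>b\<in>S. V b) = (\<Sum>i. \<Sum>b\<in>S. if hit i l' b then u i else 0)"
    unfolding V_def by (rule suminf_sum[symmetric]) (rule sumV)
  also have "\<dots> \<le> (\<Sum>i. K * (if hit i l a then r i powr s else 0))"
    by (rule suminf_le[OF mult_le summable_sum[OF sumV] summable_mult[OF sumW]])
  also have "\<dots> = K * W l a s" unfolding W_eq by (rule suminf_mult[OF sumW])
  also have "\<dots> < K * (l powr s / 512)" using W Kpos by simp
  also have "\<dots> = l / (128 * l') * (l' powr s / 512)"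
    using ratio_powr[of l l' s] l \<open>l > 0\<close> by (simp add: K_def)
  also have "\<dots> \<le> real (card S) * (l' powr s / 512)"
    using card by (intro mult_right_mono) auto
  finally have "(\<Sum>b\<in>S. V b) < (\<Sum>b\<in>S. l' powr s / 512)" by simp
  then obtain b where b: "b \<in> S" "V b < l' powr s / 512"
    by (meson not_le sum_mono)
  have "r i < l'" if "hit i l' b" for i
  proof (rule ccontr)
    assume "\<not> r i < l'"
    have "(if hit i l' b then u i else 0) \<le> V b" unfolding V_def
      by (rule order_trans[OF _ sum_le_suminf[OF sumV, of "{i}"]]) (auto simp: u0)
    then show False using b that \<open>\<not> r i < l'\<close> by (simp add: u_def)
  qed
  then have "W l' b s = V b"
    unfolding W_eq V_def by (intro suminf_cong) (simp add: u_def)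
  then show ?thesis using b by (intro bexI[of _ b]) simp_all
qed

text \<open>The descent keeps the total weight of the balls meeting the current interval below
  \<open>(l n) powr s / 512\<close>, so that no ball meeting it is longer than the interval; hence no ball
  meets all chosen intervals.\<close>

lemma cantor_escape:
  fixes c r l :: "nat \<Rightarrow> real"
  assumes s: "0 < s" "s < 1" and r: "\<And>i. r i > 0" and sum: "summable (\<lambda>i. r i powr s)"
    and l: "\<And>n. 0 < l n" "\<And>n. l (Suc n) \<le> l n" "l \<longlonglongrightarrow> 0"
    and small: "\<And>n. (l (Suc n) / l n) powr (1 - s) \<le> 1/512"
    and P0: "P 0 a0" and less: "(\<Sum>i. r i powr s) < l 0 powr s / 512"
    and children: "\<And>n a. P n a \<Longrightarrow> \<exists>S. finite S \<and> real (card S) \<ge> l n / (128 * l (Suc n)) \<and>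
      (\<forall>b\<in>S. P (Suc n) b \<and> a \<le> b \<and> b + l (Suc n) \<le> a + l n) \<and>
      (\<forall>x\<in>S. \<forall>y\<in>S. x < y \<longrightarrow> x + l (Suc n) \<le> y)"
  shows "\<exists>x. (\<forall>n. \<exists>a. P n a \<and> x \<in> {a..a + l n}) \<and> (\<forall>i. r i < \<bar>x - c i\<bar>)"
proof -
  define W where "W l a = (\<Sum>i. if c i \<in> {a - r i..a + l + r i} then r i powr s else 0)" for l a
  have sumW: "summable (\<lambda>i. if c i \<in> {a - r i..a + l + r i} then r i powr s else 0)" for l a
    by (rule summable_comparison_test'[OF sum]) auto
  have "W (l 0) a0 \<le> (\<Sum>i. r i powr s)"
    unfolding W_def by (rule suminf_le[OF _ sumW sum]) auto
  then have "\<exists>a. P 0 a \<and> W (l 0) a < l 0 powr s / 512" using P0 less by auto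
  moreover have "\<exists>b. (P (Suc n) b \<and> W (l (Suc n)) b < l (Suc n) powr s / 512) \<and>
      (a \<le> b \<and> b + l (Suc n) \<le> a + l n)"
    if Pa: "P n a \<and> W (l n) a < l n powr s / 512" for a n
  proof -
    obtain S where S: "finite S" "real (card S) \<ge> l n / (128 * l (Suc n))"
      and sub: "\<forall>b\<in>S. P (Suc n) b \<and> a \<le> b \<and> b + l (Suc n) \<le> a + l n"
      and sep: "\<forall>x\<in>S. \<forall>y\<in>S. x < y \<longrightarrow> x + l (Suc n) \<le> y"
      using children[OF conjunct1[OF Pa]] by (elim exE conjE)
    have "\<exists>b\<in>S. W (l (Suc n)) b < l (Suc n) powr s / 512"
      unfolding W_def
    proof (rule escape_step[OF s r sum l(1) l(2) small _ S(1) _ _ S(2), where a = a])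
      show "(\<Sum>i. if c i \<in> {a - r i..a + l n + r i} then r i powr s else 0) < l n powr s / 512"
        using Pa by (simp only: W_def)
    qed (use sub sep in blast)+
    then show ?thesis using sub by blast
  qed
  ultimately obtain a where a: "\<And>n. P n (a n)" "\<And>n. W (l n) (a n) < l n powr s / 512"
      "\<And>n. a n \<le> a (Suc n) \<and> a (Suc n) + l (Suc n) \<le> a n + l n"
    using dependent_nat_choice[of "\<lambda>n a. P n a \<and> W (l n) a < l n powr s / 512"
        "\<lambda>n a b. a \<le> b \<and> b + l (Suc n) \<le> a + l n"] by metis
  have "\<exists>x. x \<in> (\<Inter>n. {a n..a n + l n})"
  proof -
    have "(\<Inter>n. {a n..a n + l n}) \<noteq> {}"
    proof (rule compact_nest)
      have "{a (Suc n)..a (Suc n) + l (Suc n)} \<subseteq> {a n..a n + l n}" for n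
        using a(3)[of n] by auto
      then show "{a n..a n + l n} \<subseteq> {a m..a m + l m}" if "m \<le> n" for m n
        using that by (rule lift_Suc_antimono_le)
    qed (use l(1) in \<open>auto simp: less_imp_le\<close>)
    then show ?thesis by blast
  qed
  then obtain x where x: "\<And>n. x \<in> {a n..a n + l n}" by blast
  have "r i < \<bar>x - c i\<bar>" for i
  proof (rule ccontr)
    assume "\<not> r i < \<bar>x - c i\<bar>"
    then have hit: "c i \<in> {a n - r i..a n + l n + r i}" for n using x[of n] by auto
    have "r i \<le> l n" for n
    proof -
      have "(if c i \<in> {a n - r i..a n + l n + r i} then r i powr s else 0) \<le> W (l n) (a n)"
        unfolding W_def by (rule order_trans[OF _ sum_le_suminf[OF sumW, of "{i}"]]) auto
      then have "r i powr s \<le> W (l n) (a n)" using hit[of n] by simp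
      with a(2)[of n] powr_ge_zero[of "l n" s] have "r i powr s < l n powr s" by linarith
      then show ?thesis using s(1) r l(1) by (blast intro: powr_less_cancel2 less_imp_le)
    qed
    then have "r i \<le> 0" using l(3) by (intro LIMSEQ_le_const) auto
    then show False using r[of i] by simp
  qed
  then show ?thesis using a(1) x by blast
qed

subsection \<open>Lacunary sine series\<close>

text \<open>A closed window of at least one period contains a point of every phase \<open>t\<close>;
  the phases used are those of the crest and the trough.\<close>

lemma sin_attains_unit_values:
  fixes w u v :: real
  assumes "w > 0" "u + 2 * pi / w \<le> v"
  shows "\<exists>x\<in>{u..v}. sin (w * x) = 1" "\<exists>x\<in>{u..v}. sin (w * x) = - 1"
proof -
  have *: "\<exists>x\<in>{u..v}. sin (w * x) = sin t" for t
  proof -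
    define k where "k = \<lceil>(w * u - t) / (2 * pi)\<rceil>"
    define x where "x = (t + of_int k * (2 * pi)) / w"
    have "(w * u - t) / (2 * pi) \<le> of_int k" "of_int k \<le> (w * u - t) / (2 * pi) + 1"
      unfolding k_def by linarith+
    then have "w * u - t \<le> of_int k * (2 * pi)" "of_int k * (2 * pi) \<le> w * u - t + 2 * pi"
      by (simp_all add: field_simps)
    moreover have "w * x = t + of_int k * (2 * pi)" "w * (u + 2 * pi / w) = w * u + 2 * pi"
      using \<open>w > 0\<close> by (simp_all add: x_def field_simps)
    ultimately have "w * u \<le> w * x" "w * x \<le> w * (u + 2 * pi / w)" by linarith+
    then have "u \<le> x" "x \<le> u + 2 * pi / w" using \<open>w > 0\<close> by simp_all
    moreover have "sin (w * x) = sin t"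
      using \<open>w > 0\<close> sin_add[of t "of_int k * (2 * pi)"] sin_int_2pin[of k] cos_int_2pin[of k]
      by (simp add: x_def mult.commute)
    ultimately show ?thesis using assms(2) by (intro bexI[of _ x]) auto
  qed
  show "\<exists>x\<in>{u..v}. sin (w * x) = 1" "\<exists>x\<in>{u..v}. sin (w * x) = - 1"
    using *[of "pi/2"] *[of "-(pi/2)"] by simp_all
qed

text \<open>Connectedness of the image gives this without knowing which of \<open>p\<close> and
  \<open>q\<close> lies to the left, as is the case for troughs and crests.\<close>

lemma ivt_between:
  fixes h :: "real \<Rightarrow> real"
  assumes "continuous_on {u..v} h" "p \<in> {u..v}" "q \<in> {u..v}" "h p \<le> y" "y \<le> h q"
  shows "\<exists>z\<in>{u..v}. h z = y"
proof -
  have "connected (h ` {u..v})" using assms(1) by (intro connected_continuous_image) auto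
  then have "{h p..h q} \<subseteq> h ` {u..v}" using assms by (intro connected_contains_Icc) auto
  then have "y \<in> h ` {u..v}" using assms by auto
  then show ?thesis by blast
qed

text \<open>The factor 64 lets an interval of length \<open>l n\<close> contain a full period of the
  next wave. The growing factor \<open>real (Suc n)\<close> sends \<open>l (Suc n) / l n\<close> to
  0, which is what raises the dimension to 1.\<close>

locale wave_scales =
  fixes l :: "nat \<Rightarrow> real"
  assumes l_pos: "0 < l n" and l_0: "l 0 \<le> 1/2"
    and l_Suc: "64 * real (Suc n) * l (Suc n) \<le> l n"
begin

text \<open>The period is \<open>64 * l n\<close>, so the \<open>n\<close>-th wave varies by at most
  a tenth of its amplitude on an interval of length \<open>l n\<close>.\<close>

definition freq :: "nat \<Rightarrow> real" where
  "freq n = 2 * pi / (64 * l n)"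

text \<open>The term of index \<open>n\<close> is included, so that \<open>l n\<close> is the scale
  belonging to \<open>partial_wave n\<close>.\<close>

definition partial_wave :: "nat \<Rightarrow> real \<Rightarrow> real" where
  "partial_wave n x = (\<Sum>i<Suc n. (1/2)^i * sin (freq i * x))"

definition wave :: "real \<Rightarrow> real" where
  "wave x = (\<Sum>i. (1/2)^i * sin (freq i * x))"

lemma freq_pos: "freq n > 0"
  using l_pos[of n] by (simp add: freq_def)

lemma freq_le: "freq n \<le> 1 / (10 * l n)"
  using l_pos[of n] pi_less_4 pi_approx by (simp add: freq_def field_simps)

lemma l_Suc_le: "64 * l (Suc n) \<le> l n"
proof -
  have "64 * 1 * l (Suc n) \<le> 64 * real (Suc n) * l (Suc n)"
    using l_pos[of "Suc n"] by (intro mult_right_mono mult_left_mono) auto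
  then show ?thesis using l_Suc[of n] by simp
qed

lemma l_le_half: "l n \<le> 1/2"
proof (induction n)
  case (Suc n)
  then show ?case using l_Suc_le[of n] l_pos[of "Suc n"] by linarith
qed (rule l_0)

lemma l_ratio_tendsto: "(\<lambda>n. l (Suc n) / l n) \<longlonglongrightarrow> 0"
proof (rule tendsto_sandwich[where f = "\<lambda>_. 0" and h = "\<lambda>n. 1 / real (Suc n)",
      OF always_eventually always_eventually])
  show "\<forall>n. l (Suc n) / l n \<le> 1 / real (Suc n)"
  proof
    fix n
    have "real (Suc n) * l (Suc n) \<le> l n"
      using l_Suc[of n] mult_nonneg_nonneg[of "real (Suc n)" "l (Suc n)"] l_pos[of "Suc n"]
      unfolding mult.assoc by linarith
    then show "l (Suc n) / l n \<le> 1 / real (Suc n)"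
      using l_pos[of n] by (simp add: field_simps)
  qed
  show "(\<lambda>n. 1 / real (Suc n)) \<longlonglongrightarrow> 0" by (rule LIMSEQ_Suc[OF lim_1_over_n])
qed (use l_pos in \<open>auto simp: less_imp_le\<close>)

lemma l_tendsto: "l \<longlonglongrightarrow> 0"
proof (rule LIMSEQ_imp_Suc, rule tendsto_sandwich[where f = "\<lambda>_. 0" and h = "\<lambda>n. l (Suc n) / l n",
      OF always_eventually always_eventually])
  show "\<forall>n. l (Suc n) \<le> l (Suc n) / l n"
  proof
    fix n
    have "l (Suc n) * l n \<le> l (Suc n) * 1"
      using l_pos[of "Suc n"] l_le_half[of n] by (intro mult_left_mono) auto
    then show "l (Suc n) \<le> l (Suc n) / l n" using l_pos[of n] by (simp add: field_simps)
  qed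
qed (use l_pos l_ratio_tendsto in \<open>auto simp: less_imp_le\<close>)

lemma partial_wave_Suc:
  "partial_wave (Suc n) x = partial_wave n x + (1/2)^Suc n * sin (freq (Suc n) * x)"
  by (simp add: partial_wave_def)

text \<open>The newest wave has slope at most \<open>(1/2)^n / (10 * l n)\<close>. By
  \<open>64 * l (Suc n) \<le> l n\<close> the inherited bound shrinks to 1/256 in units of
  \<open>(1/2)^Suc n / l (Suc n)\<close>, and 1/256 + 1/10 \<le> 1/8 closes the induction.\<close>

lemma partial_wave_lipschitz:
  "\<bar>partial_wave n x - partial_wave n y\<bar> \<le> (1/2)^n / (8 * l n) * \<bar>x - y\<bar>"
proof (induction n)
  have sin_lip: "\<bar>sin a - sin b\<bar> \<le> \<bar>a - b\<bar>" for a b :: real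
  proof -
    have "\<bar>sin a - sin b\<bar> = 2 * \<bar>sin ((a - b) / 2)\<bar> * \<bar>cos ((a + b) / 2)\<bar>"
      by (simp add: sin_diff_sin abs_mult)
    also have "\<dots> \<le> 2 * \<bar>(a - b) / 2\<bar> * 1"
      by (intro mult_mono abs_sin_x_le_abs_x) auto
    finally show ?thesis by simp
  qed
  have wave_lip: "\<bar>(1/2)^n * sin (freq n * x) - (1/2)^n * sin (freq n * y)\<bar>
      \<le> (1/2)^n / (10 * l n) * \<bar>x - y\<bar>" for n
  proof -
    have "\<bar>(1/2)^n * sin (freq n * x) - (1/2)^n * sin (freq n * y)\<bar>
        = (1/2)^n * \<bar>sin (freq n * x) - sin (freq n * y)\<bar>"
      by (simp add: abs_mult flip: right_diff_distrib)
    also have "\<dots> \<le> (1/2)^n * (freq n * \<bar>x - y\<bar>)"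
      using sin_lip[of "freq n * x" "freq n * y"] freq_pos[of n]
      by (intro mult_left_mono) (auto simp: abs_mult simp flip: right_diff_distrib)
    also have "\<dots> \<le> (1/2)^n * (1 / (10 * l n) * \<bar>x - y\<bar>)"
      by (intro mult_left_mono mult_right_mono freq_le) auto
    finally show ?thesis by simp
  qed
  {
    case 0
    have "1 / (10 * l 0) * \<bar>x - y\<bar> \<le> 1 / (8 * l 0) * \<bar>x - y\<bar>"
      using l_pos[of 0] by (intro mult_right_mono divide_left_mono) auto
    then show ?case using wave_lip[of 0] by (simp add: partial_wave_def)
  next
    case (Suc n)
    have "(1/2)^n / (8 * l n) \<le> (1/2)^n / (8 * (64 * l (Suc n)))"
      using l_Suc_le[of n] l_pos[of n] l_pos[of "Suc n"] by (intro divide_left_mono) auto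
    also have "\<dots> = (1/2)^Suc n / (256 * l (Suc n))" by simp
    finally have "(1/2)^n / (8 * l n) + (1/2)^Suc n / (10 * l (Suc n))
        \<le> (1/2)^Suc n / (256 * l (Suc n)) + (1/2)^Suc n / (10 * l (Suc n))" by simp
    also have "\<dots> = ((1/2)^Suc n / l (Suc n)) * (1/256 + 1/10)"
      by (simp add: algebra_simps)
    also have "\<dots> \<le> ((1/2)^Suc n / l (Suc n)) * (1/8)"
      using l_pos[of "Suc n"] by (intro mult_left_mono) auto
    finally have "(1/2)^n / (8 * l n) + (1/2)^Suc n / (10 * l (Suc n)) \<le> (1/2)^Suc n / (8 * l (Suc n))"
      by simp
    then have "((1/2)^n / (8 * l n) + (1/2)^Suc n / (10 * l (Suc n))) * \<bar>x - y\<bar>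
        \<le> (1/2)^Suc n / (8 * l (Suc n)) * \<bar>x - y\<bar>"
      by (rule mult_right_mono) simp
    then show ?case using Suc wave_lip[of "Suc n"]
      unfolding partial_wave_Suc distrib_right by linarith
  }
qed

lemma partial_wave_diff_le:
  assumes "\<bar>x - y\<bar> \<le> l n"
  shows "\<bar>partial_wave n x - partial_wave n y\<bar> \<le> (1/2)^n / 8"
proof -
  have "(1/2)^n / (8 * l n) * \<bar>x - y\<bar> \<le> (1/2)^n / (8 * l n) * l n"
    using assms l_pos[of n] by (intro mult_left_mono) auto
  then show ?thesis using partial_wave_lipschitz[of n x y] l_pos[of n] by simp
qed

lemma continuous_partial_wave: "continuous_on A (partial_wave n)"
  unfolding partial_wave_def by (intro continuous_intros)

lemma wave_term_le: "norm ((1/2)^i * sin (freq i * x)) \<le> (1/2)^i"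
  by (simp add: abs_mult mult_left_le)

lemma summable_wave: "summable (\<lambda>i. (1/2)^i * sin (freq i * x))"
  by (rule summable_comparison_test'[OF summable_geometric[of "1/2::real"] wave_term_le]) simp

lemma partial_wave_tendsto: "(\<lambda>n. partial_wave n x) \<longlonglongrightarrow> wave x"
  unfolding partial_wave_def wave_def by (rule LIMSEQ_Suc[OF summable_LIMSEQ[OF summable_wave]])

lemma continuous_wave: "continuous_on UNIV wave"
proof (rule uniform_limit_theorem[OF always_eventually])
  show "uniform_limit UNIV (\<lambda>n x. \<Sum>i<n. (1/2)^i * sin (freq i * x)) wave sequentially"
    unfolding wave_def
    by (rule Weierstrass_m_test[OF wave_term_le summable_geometric]) simp
qed (auto intro!: continuous_intros)

text \<open>The intervals of generation \<open>n\<close> for the level \<open>y\<close>, represented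
  by their left ends. The tolerance is half the amplitude of the next wave, so adding that wave
  overshoots \<open>y\<close> in both directions.\<close>

definition scheme :: "(real \<Rightarrow> real) \<Rightarrow> real \<Rightarrow> nat \<Rightarrow> real \<Rightarrow> bool" where
  "scheme F y n a \<longleftrightarrow> 0 \<le> a \<and> a + l n \<le> 1 \<and>
    (\<forall>x\<in>{a..a + l n}. \<bar>F x + partial_wave n x - y\<bar> \<le> (1/2)^n / 4)"

text \<open>Over a distance \<open>l n\<close> both \<open>F\<close> and the partial wave vary by at
  most \<open>(1/2)^n / 8\<close>; together this is the tolerance of \<open>scheme\<close>.\<close>

lemma scheme_around_zero:
  assumes osc: "\<And>n x x'. x \<in> {0..1} \<Longrightarrow> x' \<in> {0..1} \<Longrightarrow> \<bar>x - x'\<bar> \<le> l n \<Longrightarrow> \<bar>F x - F x'\<bar> \<le> (1/2)^n / 8"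
    and uv: "0 \<le> u" "v \<le> 1" "2 * l n \<le> v - u"
    and z: "z \<in> {u..v}" "F z + partial_wave n z = y"
  shows "\<exists>a. u \<le> a \<and> a + l n \<le> v \<and> scheme F y n a"
proof -
  \<comment> \<open>The interval extends to the right of \<open>z\<close> if it fits there;
    otherwise \<open>2 * l n \<le> v - u\<close> leaves room on the left.\<close>
  define a where "a = (if z + l n \<le> v then z else z - l n)"
  have a: "u \<le> a" "a + l n \<le> v" using uv z(1) by (auto simp: a_def)
  have "\<bar>F x + partial_wave n x - y\<bar> \<le> (1/2)^n / 4" if "x \<in> {a..a + l n}" for x
  proof -
    have "\<bar>x - z\<bar> \<le> l n" using that by (auto simp: a_def split: if_splits)
    moreover have "x \<in> {0..1}" "z \<in> {0..1}" using that a uv z(1) by auto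
    ultimately have "\<bar>F x - F z\<bar> \<le> (1/2)^n / 8" "\<bar>partial_wave n x - partial_wave n z\<bar> \<le> (1/2)^n / 8"
      using osc partial_wave_diff_le by blast+
    then show ?thesis using z(2) by linarith
  qed
  then show ?thesis using a uv by (intro exI[of _ a]) (auto simp: scheme_def)
qed

text \<open>The parent is cut into consecutive periods of the next wave, with a remainder. In each
  period the new sum takes values on both sides of \<open>y\<close>, hence the value
  \<open>y\<close>, and a child fits around that point inside the period. Distinct periods make the
  children separated.\<close>

lemma scheme_children:
  assumes F: "continuous_on {0..1} F"
    and osc: "\<And>n x x'. x \<in> {0..1} \<Longrightarrow> x' \<in> {0..1} \<Longrightarrow> \<bar>x - x'\<bar> \<le> l n \<Longrightarrow> \<bar>F x - F x'\<bar> \<le> (1/2)^n / 8"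
    and a: "scheme F y n a"
  shows "\<exists>S. finite S \<and> real (card S) \<ge> l n / (128 * l (Suc n)) \<and>
      (\<forall>b\<in>S. scheme F y (Suc n) b \<and> a \<le> b \<and> b + l (Suc n) \<le> a + l n) \<and>
      (\<forall>x\<in>S. \<forall>y\<in>S. x < y \<longrightarrow> x + l (Suc n) \<le> y)"
proof -
  define T where "T = 64 * l (Suc n)"
  define N where "N = nat \<lfloor>l n / T\<rfloor>"
  have T: "T > 0" "T \<le> l n" "2 * l (Suc n) \<le> T" "2 * pi / freq (Suc n) = T"
    using l_Suc_le[of n] l_pos[of "Suc n"] by (auto simp: T_def freq_def)
  have NT: "real N * T \<le> l n"
  proof -
    have "real N \<le> l n / T" using T l_pos[of n] by (simp add: N_def)
    then show ?thesis using T(1) by (simp add: field_simps)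
  qed
  have "\<exists>b. a + real k * T \<le> b \<and> b + l (Suc n) \<le> a + real (Suc k) * T \<and> scheme F y (Suc n) b"
    if "k < N" for k
  proof -
    define u v where "u = a + real k * T" and "v = a + real (Suc k) * T"
    have "real (Suc k) * T \<le> real N * T" using that T(1) by (intro mult_right_mono) auto
    then have v: "v \<le> a + l n" using NT by (simp add: v_def)
    have u: "a \<le> u" using T(1) by (simp add: u_def)
    have vu: "v = u + T" by (simp add: u_def v_def algebra_simps)
    have sub: "{u..v} \<subseteq> {a..a + l n}" using u v by auto
    have a01: "0 \<le> a" "a + l n \<le> 1" using a by (auto simp: scheme_def)
    obtain p where p: "p \<in> {u..v}" "sin (freq (Suc n) * p) = - 1"
      using sin_attains_unit_values(2)[OF freq_pos, of u "Suc n" v] T(4) vu by auto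
    obtain q where q: "q \<in> {u..v}" "sin (freq (Suc n) * q) = 1"
      using sin_attains_unit_values(1)[OF freq_pos, of u "Suc n" v] T(4) vu by auto
    have near: "\<bar>F x + partial_wave n x - y\<bar> \<le> (1/2)^n / 4" if "x \<in> {u..v}" for x
      using a that sub by (auto simp: scheme_def)
    \<comment> \<open>The amplitude of the new wave dominates the old deviation from
      \<open>y\<close>, which fixes the sign at the trough \<open>p\<close> and at the crest
      \<open>q\<close>.\<close>
    have half: "(1/2::real)^n / 4 \<le> (1/2)^Suc n" by simp
    have "continuous_on {u..v} (\<lambda>x. F x + partial_wave (Suc n) x)"
      using sub a01 by (intro continuous_on_add continuous_partial_wave continuous_on_subset[OF F]) auto
    moreover have "F p + partial_wave (Suc n) p \<le> y"
      using near[OF p(1)] half unfolding partial_wave_Suc p(2) by linarith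
    moreover have "y \<le> F q + partial_wave (Suc n) q"
      using near[OF q(1)] half unfolding partial_wave_Suc q(2) by linarith
    ultimately obtain z where "z \<in> {u..v}" "F z + partial_wave (Suc n) z = y"
      using ivt_between[of u v "\<lambda>x. F x + partial_wave (Suc n) x" p q y] p(1) q(1) by auto
    then show ?thesis
      unfolding u_def[symmetric] v_def[symmetric]
      using scheme_around_zero[where F = F and u = u and v = v and n = "Suc n" and z = z, OF osc] u v vu T(3) a01 by auto
  qed
  then obtain b where b: "\<And>k. k < N \<Longrightarrow> a + real k * T \<le> b k"
    "\<And>k. k < N \<Longrightarrow> b k + l (Suc n) \<le> a + real (Suc k) * T"
    "\<And>k. k < N \<Longrightarrow> scheme F y (Suc n) (b k)"
    by metis
  have b_mono: "b i + l (Suc n) \<le> b j" if "i < j" "j < N" for i j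
  proof -
    have "real (Suc i) * T \<le> real j * T" using that T(1) by (intro mult_right_mono) auto
    then show ?thesis using b(1)[of j] b(2)[of i] that by linarith
  qed
  have b_less: "b i < b j" if "i < j" "j < N" for i j
    using b_mono[OF that] l_pos[of "Suc n"] by linarith
  have "inj_on b {..<N}"
    by (rule linorder_inj_onI) (use b_less in \<open>force+\<close>)
  then have "card (b ` {..<N}) = N" by (simp add: card_image)
  moreover have "l n / (128 * l (Suc n)) \<le> real N"
  proof -
    \<comment> \<open>Rounding down a number that is at least 1 loses at most half of it; this turns
      the 64 of the period into 128.\<close>
    define q where "q = l n / T"
    have "q \<ge> 1" using T by (simp add: q_def)
    then have "1 \<le> \<lfloor>q\<rfloor>" by simp
    then have "real N = of_int \<lfloor>q\<rfloor>" "1 \<le> real N" by (simp_all add: N_def q_def)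
    then have "q / 2 \<le> real N" by linarith
    then show ?thesis by (simp add: q_def T_def)
  qed
  moreover have "b k + l (Suc n) \<le> a + l n" if "k < N" for k
  proof -
    have "real (Suc k) * T \<le> real N * T" using that T(1) by (intro mult_right_mono) auto
    then show ?thesis using b(2)[OF that] NT by linarith
  qed
  moreover have "a \<le> b k" if "k < N" for k
  proof -
    have "0 \<le> real k * T" using T(1) by simp
    then show ?thesis using b(1)[OF that] by linarith
  qed
  moreover have "b i + l (Suc n) \<le> b j" if "i < N" "j < N" "b i < b j" for i j
    using that b_less[of j i] b_mono[of i j] by (cases i j rule: linorder_cases) auto
  ultimately show ?thesis
    using b(3) by (intro exI[of _ "b ` {..<N}"]) auto
qed

text \<open>Balls of small total weight cannot cover the level set. The scheme starts at a
  generation \<open>m\<close> so late that the partial sums already lie on both sides of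
  \<open>y\<close> at \<open>p\<close> and \<open>q\<close>, and that the scale ratios meet the
  smallness condition for \<open>s\<close>.\<close>

lemma wave_level_set_escape:
  assumes F: "continuous_on {0..1} F"
    and osc: "\<And>n x x'. x \<in> {0..1} \<Longrightarrow> x' \<in> {0..1} \<Longrightarrow> \<bar>x - x'\<bar> \<le> l n \<Longrightarrow> \<bar>F x - F x'\<bar> \<le> (1/2)^n / 8"
    and p: "p \<in> {0..1}" "F p + wave p < y" and q: "q \<in> {0..1}" "y < F q + wave q"
    and s: "0 < s" "s < 1"
  shows "\<exists>\<epsilon>>0. \<forall>c r :: nat \<Rightarrow> real. (\<forall>i. r i > 0) \<longrightarrow> summable (\<lambda>i. r i powr s) \<longrightarrow>
    (\<Sum>i. r i powr s) < \<epsilon> \<longrightarrow> (\<exists>x\<in>{0..1}. F x + wave x = y \<and> (\<forall>i. r i < \<bar>x - c i\<bar>))"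
proof -
  have "(\<lambda>n. F p + partial_wave n p) \<longlonglongrightarrow> F p + wave p"
    "(\<lambda>n. F q + partial_wave n q) \<longlonglongrightarrow> F q + wave q"
    by (intro tendsto_add tendsto_const partial_wave_tendsto)+
  then have ev: "eventually (\<lambda>n. F p + partial_wave n p < y) sequentially"
    "eventually (\<lambda>n. y < F q + partial_wave n q) sequentially"
    using p q by (auto elim: order_tendstoD)
  have "(\<lambda>n. (l (Suc n) / l n) powr (1 - s)) \<longlonglongrightarrow> 0 powr (1 - s)"
    using s l_pos by (intro tendsto_powr' l_ratio_tendsto tendsto_const) (auto simp: less_imp_le)
  then have "eventually (\<lambda>n. (l (Suc n) / l n) powr (1 - s) < 1/512) sequentially"
    by (rule order_tendstoD) simp
  with ev have "eventually (\<lambda>n. F p + partial_wave n p < y \<and> y < F q + partial_wave n q \<and>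
      (l (Suc n) / l n) powr (1 - s) < 1/512) sequentially"
    by eventually_elim simp
  then obtain m where m: "\<And>n. n \<ge> m \<Longrightarrow> F p + partial_wave n p < y \<and> y < F q + partial_wave n q \<and>
      (l (Suc n) / l n) powr (1 - s) < 1/512"
    unfolding eventually_sequentially by blast
  have "continuous_on {0..1} (\<lambda>x. F x + partial_wave m x)"
    by (intro continuous_on_add continuous_partial_wave F)
  from ivt_between[OF this p(1) q(1), of y] m[OF order_refl]
  obtain z where "z \<in> {0..1}" "F z + partial_wave m z = y"
    by (blast intro: less_imp_le)
  then obtain a0 where a0: "scheme F y m a0"
    using scheme_around_zero[where F = F and u = 0 and v = 1 and n = m and z = z, OF osc] l_le_half[of m] by auto
  \<comment> \<open>\<open>m\<close> was chosen before any balls are given, so the threshold of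
    \<open>cantor_escape\<close> at the starting scale \<open>l m\<close> can serve as
    \<epsilon>.\<close>
  show ?thesis
  proof (intro exI[of _ "l m powr s / 512"] conjI allI impI)
    show "l m powr s / 512 > 0" using l_pos[of m] by simp
    fix c r :: "nat \<Rightarrow> real"
    assume r: "\<forall>i. r i > 0" "summable (\<lambda>i. r i powr s)" "(\<Sum>i. r i powr s) < l m powr s / 512"
    have "\<exists>x. (\<forall>n. \<exists>a. scheme F y (m + n) a \<and> x \<in> {a..a + l (m + n)}) \<and> (\<forall>i. r i < \<bar>x - c i\<bar>)"
    proof (rule cantor_escape[OF s, of r "\<lambda>n. l (m + n)" "\<lambda>n. scheme F y (m + n)"])
      show "(\<lambda>n. l (m + n)) \<longlonglongrightarrow> 0"
        using LIMSEQ_ignore_initial_segment[OF l_tendsto, of m] by (simp add: add.commute)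
      show "l (m + Suc n) \<le> l (m + n)" for n
        using l_Suc_le[of "m + n"] l_pos[of "Suc (m + n)"] by simp
      show "(l (m + Suc n) / l (m + n)) powr (1 - s) \<le> 1/512" for n
        using m[of "m + n"] by simp
      show "scheme F y (m + 0) a0" using a0 by simp
    qed (use r l_pos scheme_children[OF F osc] in simp_all)
    then obtain x where x: "\<And>n. \<exists>a. scheme F y (m + n) a \<and> x \<in> {a..a + l (m + n)}"
      "\<And>i. r i < \<bar>x - c i\<bar>" by blast
    have x01: "x \<in> {0..1}" using x(1)[of 0] by (auto simp: scheme_def)
    have close: "\<bar>F x + partial_wave (m + n) x - y\<bar> \<le> (1/2)^(m + n) / 4" for n
      using x(1)[of n] by (auto simp: scheme_def)
    \<comment> \<open>The tolerances of the generations tend to 0, so in the limit the level is hit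
      exactly.\<close>
    have "(\<lambda>n. \<bar>F x + partial_wave n x - y\<bar>) \<longlonglongrightarrow> \<bar>F x + wave x - y\<bar>"
      by (intro tendsto_intros partial_wave_tendsto)
    moreover have "(\<lambda>n. (1/2::real)^n / 4) \<longlonglongrightarrow> 0 / 4"
      by (intro tendsto_divide tendsto_const LIMSEQ_realpow_zero) auto
    ultimately have "\<bar>F x + wave x - y\<bar> \<le> 0 / 4"
    proof (rule LIMSEQ_le)
      show "\<exists>N. \<forall>n\<ge>N. \<bar>F x + partial_wave n x - y\<bar> \<le> (1/2)^n / 4"
        using close by (intro exI[of _ m]) (metis le_Suc_ex)
    qed
    then show "\<exists>x\<in>{0..1}. F x + wave x = y \<and> (\<forall>i. r i < \<bar>x - c i\<bar>)"
      using x01 x(2) by (intro bexI[of _ x]) auto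
  qed
qed

end

subsection \<open>Hausdorff measure and dimension\<close>

text \<open>A cover of small weight turns into balls: each nonempty member lies in the ball around
  any of its points whose radius is its diameter. A point of \<open>A\<close> outside all slightly
  enlarged balls contradicts the cover.\<close>

lemma hausdorff_measure_nonzero:
  fixes A :: "'a::metric_space set"
  assumes s: "0 < s" and \<epsilon>: "0 < \<epsilon>"
    and escape: "\<And>c r :: nat \<Rightarrow> _. (\<forall>i. 0 < r i) \<Longrightarrow> summable (\<lambda>i. r i powr s) \<Longrightarrow>
      (\<Sum>i. r i powr s) < \<epsilon> \<Longrightarrow> \<exists>x\<in>A. \<forall>i. r i < dist x (c i)"
  shows "hausdorff_measure s A \<noteq> 0"
proof
  assume "hausdorff_measure s A = 0"
  moreover have "hausdorff_premeasure s 1 A \<le> hausdorff_measure s A"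
    unfolding hausdorff_measure_def by (rule SUP_upper) simp
  ultimately have "hausdorff_premeasure s 1 A < ennreal (\<epsilon> / 2)" using \<epsilon> by simp
  then obtain U :: "nat \<Rightarrow> 'a set" where U: "A \<subseteq> (\<Union>i. U i)" "\<And>i. bounded (U i)"
      "(\<Sum>i. diam_powr s (U i)) < ennreal (\<epsilon> / 2)"
    unfolding hausdorff_premeasure_def INF_less_iff by blast
  define d where "d i = (if U i = {} then 0 else diameter (U i) powr s)" for i
  \<comment> \<open>The geometric padding makes all radii positive, even for empty and one-point
    members, and adds only \<open>\<epsilon> / 2\<close> to the total weight.\<close>
  define r where "r i = (d i + \<epsilon> / 2 * (1/2)^Suc i) powr (1 / s)" for i
  \<comment> \<open>For empty \<open>U i\<close> the centre is arbitrary, which is harmless because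
    the escaping point lies in a nonempty member.\<close>
  define c where "c i = (SOME x. x \<in> U i)" for i
  have d0: "0 \<le> d i" for i by (simp add: d_def)
  have "diam_powr s (U i) = ennreal (d i)" for i
    using s by (simp add: diam_powr_def d_def)
  then have d_less: "(\<Sum>i. ennreal (d i)) < ennreal (\<epsilon> / 2)" using U(3) by simp
  then have sum_d: "summable d"
    by (intro summable_suminf_not_top d0) (auto dest: less_trans[OF _ ennreal_less_top])
  have "(\<Sum>i. d i) < \<epsilon> / 2"
    using d_less \<epsilon> suminf_nonneg[OF sum_d d0] unfolding suminf_ennreal2[OF d0 sum_d]
    by (simp add: ennreal_less_iff)
  have pos: "0 < d i + \<epsilon> / 2 * (1/2)^Suc i" for i
    using d0[of i] \<epsilon> by (intro add_nonneg_pos mult_pos_pos zero_less_power) auto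
  then have r_powr: "r i powr s = d i + \<epsilon> / 2 * (1/2)^Suc i" for i

    using s abs_of_pos[OF pos[of i]] by (simp add: r_def powr_powr del: power_Suc)
  have "(\<lambda>i. r i powr s) sums ((\<Sum>i. d i) + \<epsilon> / 2 * 1)"
    unfolding r_powr by (intro sums_add summable_sums sum_d sums_mult power_half_series)
  then have "summable (\<lambda>i. r i powr s)" "(\<Sum>i. r i powr s) < \<epsilon>"
    using \<open>(\<Sum>i. d i) < \<epsilon> / 2\<close> by (auto simp: sums_iff)
  moreover have "\<forall>i. 0 < r i" using pos by (simp add: r_def less_imp_neq[symmetric])
  ultimately obtain x where x: "x \<in> A" "\<And>i. r i < dist x (c i)" using escape by blast
  then obtain i where i: "x \<in> U i" using U(1) by blast
  then have "c i \<in> U i" unfolding c_def by (rule someI)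
  then have "dist x (c i) \<le> diameter (U i)" using U(2) i by (intro diameter_bounded_bound)
  also have "\<dots> = d i powr (1 / s)"
    using i s diameter_ge_0[OF U(2)[of i]] by (auto simp: d_def powr_powr)
  also have "\<dots> \<le> r i"
    unfolding r_def using s d0 \<epsilon> by (intro powr_mono2) auto
  finally show False using x(2)[of i] by simp
qed

lemma hausdorff_dim_ge_1:
  fixes A :: "'a::metric_space set"
  assumes "\<And>s. 0 < s \<Longrightarrow> s < 1 \<Longrightarrow> hausdorff_measure s A \<noteq> 0"
  shows "1 \<le> hausdorff_dim A"
  unfolding hausdorff_dim_def
proof (rule INF_greatest)
  fix s assume "s \<in> {s. 0 \<le> s \<and> hausdorff_measure s A = 0}"
  then have s: "0 \<le> s" "hausdorff_measure s A = 0" by auto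
  have "hausdorff_premeasure t \<delta> ({} :: 'a set) \<le> 0" if "\<delta> > 0" for t \<delta>
    unfolding hausdorff_premeasure_def using that
    by (intro INF_lower2[of "\<lambda>_. {}"]) (auto simp: diam_powr_def)
  then have "hausdorff_measure (1/2) ({} :: 'a set) = 0"
    unfolding hausdorff_measure_def by (intro antisym SUP_least) auto
  then have ne: "A \<noteq> {}" using assms[of "1/2"] by auto
  \<comment> \<open>The hypothesis does not speak of exponent 0. There every nonempty member of a
    cover has weight 1, and a cover of the nonempty \<open>A\<close> has such a member.\<close>
  have "s \<noteq> 0"
  proof
    assume "s = 0"
    moreover have "hausdorff_premeasure 0 1 A \<le> hausdorff_measure 0 A"
      unfolding hausdorff_measure_def by (rule SUP_upper) simp
    ultimately have "hausdorff_premeasure 0 1 A < 1" using s by simp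
    then obtain U :: "nat \<Rightarrow> 'a set" where U: "A \<subseteq> (\<Union>i. U i)" "(\<Sum>i. diam_powr 0 (U i)) < 1"
      unfolding hausdorff_premeasure_def INF_less_iff by blast
    obtain i where "U i \<noteq> {}" using ne U(1) by blast
    then have "1 = (\<Sum>i\<in>{i}. diam_powr 0 (U i))" by (simp add: diam_powr_def)
    also have "\<dots> \<le> (\<Sum>i. diam_powr 0 (U i))" by (intro sum_le_suminf) auto
    finally show False using U(2) by simp
  qed
  then have "\<not> s < 1" using assms[of s] s by auto
  then show "1 \<le> ennreal s" by simp
qed

lemma dist_unit_interval: "dist x y = \<bar>Rep_unit_interval x - Rep_unit_interval y\<bar>"
  by (simp add: dist_unit_interval_def dist_real_def)

text \<open>Covering by \<open>n\<close> intervals of length \<open>1 / n\<close> costs at most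
  \<open>real n powr (1 - s)\<close>, which tends to 0 for every \<open>s > 1\<close>.\<close>

lemma hausdorff_dim_unit_interval_le_1: "hausdorff_dim (A :: unit_interval set) \<le> 1"
proof -
  have zero: "hausdorff_measure s A = 0" if "s > 1" for s
  proof -
    have "hausdorff_premeasure s \<delta> A \<le> 0 + ennreal e" if "\<delta> > 0" "e > 0" for \<delta> e
    proof -
      have "eventually (\<lambda>n. real n powr (1 - s) < e) sequentially"
        using \<open>s > 1\<close> \<open>e > 0\<close>
        by (intro order_tendstoD[OF tendsto_neg_powr] filterlim_real_sequentially) auto
      moreover have "eventually (\<lambda>n. 1 / real n < \<delta>) sequentially"
        using \<open>\<delta> > 0\<close> by (intro order_tendstoD[OF lim_1_over_n])
      ultimately have "eventually (\<lambda>n. real n powr (1 - s) < e \<and> 1 / real n < \<delta> \<and> 0 < n) sequentially"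
        using eventually_gt_at_top[of 0] by eventually_elim simp
      then obtain n where n: "real n powr (1 - s) < e" "1 / real n < \<delta>" "0 < n"
        by (blast dest: eventually_happens'[OF sequentially_bot])
      \<comment> \<open>From index \<open>n\<close> on the members are empty, so the infinite sum
        reduces to \<open>n\<close> terms.\<close>
      define U where "U i = {x. i < n \<and> real i / n \<le> Rep_unit_interval x \<and> Rep_unit_interval x \<le> real (Suc i) / n}" for i
      have dist: "dist x y \<le> 1 / n" if "x \<in> U i" "y \<in> U i" for x y i
        using that n(3) by (auto simp: U_def dist_unit_interval field_simps abs_le_iff)
      have bdd: "bounded (U i)" for i
        unfolding bounded_def using dist by blast
      have diam: "diameter (U i) \<le> 1 / n" for i
        using dist[of _ i] n(3) by (auto simp: diameter_def intro!: cSUP_least)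
      have "A \<subseteq> (\<Union>i. U i)"
      proof
        fix x
        have x: "0 \<le> Rep_unit_interval x" "Rep_unit_interval x \<le> 1"
          using Rep_unit_interval[of x] by auto
        show "x \<in> (\<Union>i. U i)"
        \<comment> \<open>At the right endpoint the floor would give the index \<open>n\<close>,
          whose member is empty; the last interval contains this point.\<close>
        proof (cases "Rep_unit_interval x = 1")
          case True
          then have "x \<in> U (n - 1)" using n(3) by (auto simp: U_def of_nat_diff)
          then show ?thesis by blast
        next
          case False
          define i where "i = nat \<lfloor>n * Rep_unit_interval x\<rfloor>"
          have i: "real i \<le> n * Rep_unit_interval x" "n * Rep_unit_interval x < real i + 1"
            using x(1) by (simp_all add: i_def)
          have "n * Rep_unit_interval x < real n * 1" using False x n(3) by (intro mult_strict_left_mono) auto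
          then have "i < n" using i by linarith
          then have "x \<in> U i" using i n(3) by (simp add: U_def field_simps)
          then show ?thesis by blast
        qed
      qed
      moreover have "\<forall>i. bounded (U i) \<and> diameter (U i) \<le> \<delta>"
        using bdd diam n(2) by (meson less_imp_le order_trans)
      ultimately have "hausdorff_premeasure s \<delta> A \<le> (\<Sum>i. diam_powr s (U i))"
        unfolding hausdorff_premeasure_def by (intro INF_lower) auto
      also have "\<dots> = (\<Sum>i<n. diam_powr s (U i))"
        by (rule suminf_finite) (auto simp: U_def diam_powr_def)
      also have "\<dots> \<le> (\<Sum>i<n. ennreal ((1 / n) powr s))"
        using diam bdd \<open>s > 1\<close>
        by (intro sum_mono) (auto simp: diam_powr_def intro!: ennreal_leI powr_mono2 diameter_ge_0)
      also have "\<dots> = ennreal (real n * (1 / n) powr s)"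
        by (simp add: ennreal_mult ennreal_of_nat_eq_real_of_nat)
      also have "real n * (1 / n) powr s = real n powr (1 - s)"
        using n(3) by (simp add: powr_diff powr_divide)
      also have "ennreal (real n powr (1 - s)) \<le> 0 + ennreal e" using n(1) by (simp add: ennreal_leI)
      finally show ?thesis .
    qed
    then have "hausdorff_premeasure s \<delta> A \<le> 0" if "\<delta> > 0" for \<delta>
      using that by (blast intro: ennreal_le_epsilon)
    then have "hausdorff_measure s A \<le> 0"
      unfolding hausdorff_measure_def by (intro SUP_least) simp
    then show ?thesis by simp
  qed
  show ?thesis
  proof (rule ennreal_le_epsilon)
    fix e :: real assume "e > 0"
    then have "hausdorff_dim A \<le> ennreal (1 + e)"
      unfolding hausdorff_dim_def by (intro INF_lower) (use zero in auto)
    then show "hausdorff_dim A \<le> 1 + ennreal e" using \<open>e > 0\<close> by simp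
  qed
qed

subsection \<open>Level sets of perturbed functions\<close>

text \<open>The tolerance is the oscillation that the Cantor scheme allows \<open>F\<close> on
  length \<open>l n\<close>, once \<open>l n \<le> m n\<close>.\<close>

definition equicontinuous_set :: "(nat \<Rightarrow> real) \<Rightarrow> C01 set" where
  "equicontinuous_set m = {f. \<forall>n x x'. dist x x' \<le> m n \<longrightarrow> \<bar>apply_bcontfun f x - apply_bcontfun f x'\<bar> \<le> (1/2)^n / 8}"

lemma continuous_on_bcontfun_eval: "continuous_on S (\<lambda>f. apply_bcontfun f x)"
  unfolding continuous_on_iff using dist_fun_lt_imp_dist_val_lt by blast

text \<open>This replaces inner regularity by compact sets, which would require the separability of
  \<open>C[0,1]\<close>; continuity of the measure along increasing sets suffices.\<close>

lemma equicontinuous_set_positive_measure: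
  fixes \<nu> :: "C01 measure"
  assumes "prob_space \<nu>" and sets: "sets \<nu> = sets borel"
  shows "\<exists>m. (\<forall>n. 0 < m n) \<and> equicontinuous_set m \<in> sets \<nu> \<and> emeasure \<nu> (equicontinuous_set m) \<noteq> 0"
proof -
  interpret prob_space \<nu> by fact
  have space: "space \<nu> = UNIV" using sets_eq_imp_space_eq[OF sets] by simp
  define E :: "nat \<Rightarrow> nat \<Rightarrow> C01 set" where
    "E n k = {f. \<forall>x x'. dist x x' \<le> 1 / real (Suc k) \<longrightarrow> \<bar>apply_bcontfun f x - apply_bcontfun f x'\<bar> \<le> (1/2)^n / 8}" for n k
  have E_sets: "E n k \<in> sets \<nu>" for n k
  proof -
    have "closed (E n k)"
      unfolding E_def
      by (intro closed_Collect_all closed_Collect_imp open_Collect_const closed_Collect_le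
          continuous_intros continuous_on_bcontfun_eval)
    then show ?thesis unfolding sets by (rule borel_closed)
  qed
  \<comment> \<open>By uniform continuity the closed sets \<open>E n k\<close> increase to the whole
    space as \<open>k\<close> grows. The masses lost over all \<open>n\<close> then sum to at most
    1/2, so the intersection keeps positive mass.\<close>
  have "\<exists>k. prob (space \<nu> - E n k) < (1/2)^(n + 2)" for n
  proof -
    have "incseq (E n)"
    proof (rule incseq_SucI, rule subsetI)
      fix k f assume "f \<in> E n k"
      moreover have "1 / real (Suc (Suc k)) \<le> 1 / real (Suc k)" by (simp add: frac_le)
      ultimately show "f \<in> E n (Suc k)" unfolding E_def by force
    qed
    moreover have "(\<Union>k. E n k) = space \<nu>"
    proof -
      have "\<exists>k. f \<in> E n k" for f
      proof -
        have "uniformly_continuous_on UNIV (apply_bcontfun f)"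
          by (intro compact_uniformly_continuous compact_UNIV_unit_interval) simp
        moreover have "(1/2::real)^n / 8 > 0" by simp
        ultimately obtain d where d: "d > 0"
          "\<And>x x'. dist x' x < d \<Longrightarrow> dist (apply_bcontfun f x') (apply_bcontfun f x) < (1/2)^n / 8"
          unfolding uniformly_continuous_on_def by (metis UNIV_I)
        obtain k where "1 / real (Suc k) < d" using d(1) nat_approx_posE by blast
        then have "f \<in> E n k"
          using d(2) unfolding E_def dist_real_def by (fastforce intro: less_imp_le)
        then show ?thesis ..
      qed
      then show ?thesis by (auto simp: space)
    qed
    ultimately have "(\<lambda>k. prob (E n k)) \<longlonglongrightarrow> 1"
      using finite_Lim_measure_incseq[of "E n"] E_sets prob_space by auto
    then have "eventually (\<lambda>k. 1 - (1/2)^(n + 2) < prob (E n k)) sequentially"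
      by (rule order_tendstoD) simp
    then obtain k where "1 - (1/2)^(n + 2) < prob (E n k)"
      by (blast dest: eventually_happens'[OF sequentially_bot])
    then show ?thesis using prob_compl[OF E_sets[of n k]] by (intro exI[of _ k]) linarith
  qed
  then obtain k where k: "\<And>n. prob (space \<nu> - E n (k n)) < (1/2)^(n + 2)" by metis
  define m where "m n = 1 / real (Suc (k n))" for n
  have eq: "equicontinuous_set m = (\<Inter>n. E n (k n))"
    by (auto simp: equicontinuous_set_def E_def m_def)
  have in_sets: "equicontinuous_set m \<in> sets \<nu>"
    unfolding eq by (intro sets.countable_INT) (use E_sets in auto)
  have geo: "(\<lambda>n. (1/2::real)^(n + 2)) sums (1/2)"
    using sums_mult[OF power_half_series, of "1/2"] by simp
  have sum: "summable (\<lambda>n. prob (space \<nu> - E n (k n)))"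
    by (rule summable_comparison_test'[OF sums_summable[OF geo]]) (use k in \<open>auto simp: less_imp_le\<close>)
  have "prob (\<Union>n. space \<nu> - E n (k n)) \<le> (\<Sum>n. prob (space \<nu> - E n (k n)))"
    using E_sets by (intro finite_measure_subadditive_countably sum) auto
  also have "\<dots> \<le> (\<Sum>n. (1/2)^(n + 2))"
    by (intro suminf_le sum sums_summable[OF geo]) (use k in \<open>auto simp: less_imp_le\<close>)
  also have "\<dots> = 1/2" using geo by (simp add: sums_iff)
  also have "(\<Union>n. space \<nu> - E n (k n)) = space \<nu> - equicontinuous_set m" unfolding eq by auto
  finally have "prob (equicontinuous_set m) \<noteq> 0" using prob_compl[OF in_sets] by auto
  then have "emeasure \<nu> (equicontinuous_set m) \<noteq> 0" by (simp add: measure_def) (metis enn2real_0)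
  then show ?thesis using in_sets by (intro exI[of _ m]) (auto simp: m_def)
qed

text \<open>The wave is adapted to the modulus \<open>m\<close> supplied by the measure: each scale
  is the largest one that both constraints permit.\<close>

lemma ex_wave_scales_le:
  assumes "\<And>n. (0::real) < m n"
  shows "\<exists>l. wave_scales l \<and> (\<forall>n. l n \<le> m n)"
proof -
  define l where "l = rec_nat (min (1/2) (m 0)) (\<lambda>n a. min (a / (64 * real (Suc n))) (m (Suc n)))"
  have l: "l 0 = min (1/2) (m 0)" "\<And>n. l (Suc n) = min (l n / (64 * real (Suc n))) (m (Suc n))"
    by (simp_all add: l_def)
  have pos: "0 < l n" for n by (induction n) (simp_all add: l assms)
  have "64 * real (Suc n) * l (Suc n) \<le> l n" for n
  proof -
    have "l (Suc n) \<le> l n / (64 * real (Suc n))" by (simp add: l)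
    then show ?thesis by (simp add: field_simps)
  qed
  moreover have "l n \<le> m n" for n by (cases n) (simp_all add: l)
  ultimately show ?thesis using pos l(1) by (intro exI[of _ l]) (auto simp: wave_scales_def)
qed

context wave_scales
begin

definition wave_bcontfun :: C01 where
  "wave_bcontfun = Bcontfun (\<lambda>x. wave (Rep_unit_interval x))"

lemma apply_wave_bcontfun: "apply_bcontfun wave_bcontfun x = wave (Rep_unit_interval x)"
proof -
  have "continuous_on UNIV Rep_unit_interval"
    unfolding continuous_on_iff by (auto simp: dist_unit_interval_def)
  then have c: "continuous_on UNIV (\<lambda>x. wave (Rep_unit_interval x))"
    by (rule continuous_on_compose2[OF continuous_wave]) auto
  then have "compact (range (\<lambda>x. wave (Rep_unit_interval x)))"
    by (intro compact_continuous_image compact_UNIV_unit_interval)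
  with c have "(\<lambda>x. wave (Rep_unit_interval x)) \<in> bcontfun"
    by (simp add: bcontfun_def compact_imp_bounded)
  then show ?thesis by (simp add: wave_bcontfun_def Bcontfun_inverse)
qed

text \<open>Since \<open>y\<close> lies strictly between the extreme values, points attaining them
  serve as \<open>p\<close> and \<open>q\<close> in \<open>wave_level_set_escape\<close>. The
  isometry \<open>Rep_unit_interval\<close> carries the balls to the real line, and the escaping
  point back.\<close>

lemma hausdorff_dim_level_set:
  assumes f: "f \<in> equicontinuous_set m" and m: "\<And>n. l n \<le> m n"
    and y: "y \<in> {min_val (f + wave_bcontfun)<..<max_val (f + wave_bcontfun)}"
  shows "hausdorff_dim (apply_bcontfun (f + wave_bcontfun) -` {y}) = 1"
proof (rule antisym[OF hausdorff_dim_unit_interval_le_1 hausdorff_dim_ge_1])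
  fix s :: real assume s: "0 < s" "s < 1"
  \<comment> \<open>Outside \<open>{0..1}\<close> the values of \<open>F\<close> are unspecified;
    continuity and oscillation are only claimed on \<open>{0..1}\<close>.\<close>
  define F where "F x = apply_bcontfun f (Abs_unit_interval x)" for x
  have sum_eq: "apply_bcontfun (f + wave_bcontfun) x = F (Rep_unit_interval x) + wave (Rep_unit_interval x)" for x
    by (simp add: F_def Rep_unit_interval_inverse apply_wave_bcontfun)
  have dist_Abs: "dist (Abs_unit_interval x) (Abs_unit_interval x') = \<bar>x - x'\<bar>"
    if "x \<in> {0..1}" "x' \<in> {0..1}" for x x'
    using that by (simp add: dist_unit_interval Abs_unit_interval_inverse)
  have "continuous_on {0..1} Abs_unit_interval"
    unfolding continuous_on_iff using dist_Abs by (auto simp: dist_real_def)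
  then have F: "continuous_on {0..1} F"
    unfolding F_def by (intro continuous_on_compose2[OF continuous_on_apply_bcontfun[of UNIV]]) auto
  have osc: "\<bar>F x - F x'\<bar> \<le> (1/2)^n / 8"
    if "x \<in> {0..1}" "x' \<in> {0..1}" "\<bar>x - x'\<bar> \<le> l n" for n x x'
    using f m[of n] that dist_Abs[of x x'] by (auto simp: equicontinuous_set_def F_def)
  obtain p where p: "F (Rep_unit_interval p) + wave (Rep_unit_interval p) < y"
    using min_val_attained(1)[of "f + wave_bcontfun"] y by (auto simp: sum_eq simp del: plus_bcontfun.rep_eq)
  obtain q where q: "y < F (Rep_unit_interval q) + wave (Rep_unit_interval q)"
    using max_val_attained(1)[of "f + wave_bcontfun"] y by (auto simp: sum_eq simp del: plus_bcontfun.rep_eq)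
  obtain \<epsilon> where \<epsilon>: "\<epsilon> > 0" "\<And>c r :: nat \<Rightarrow> real. (\<forall>i. r i > 0) \<Longrightarrow> summable (\<lambda>i. r i powr s) \<Longrightarrow>
    (\<Sum>i. r i powr s) < \<epsilon> \<Longrightarrow> \<exists>x\<in>{0..1}. F x + wave x = y \<and> (\<forall>i. r i < \<bar>x - c i\<bar>)"
    using wave_level_set_escape[OF F osc Rep_unit_interval p Rep_unit_interval q s] by blast
  show "hausdorff_measure s (apply_bcontfun (f + wave_bcontfun) -` {y}) \<noteq> 0"
  proof (rule hausdorff_measure_nonzero[OF s(1) \<epsilon>(1)])
    fix c :: "nat \<Rightarrow> unit_interval" and r :: "nat \<Rightarrow> real"
    assume r: "\<forall>i. 0 < r i" "summable (\<lambda>i. r i powr s)" "(\<Sum>i. r i powr s) < \<epsilon>"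
    obtain x where x: "x \<in> {0..1}" "F x + wave x = y" "\<And>i. r i < \<bar>x - Rep_unit_interval (c i)\<bar>"
      using \<epsilon>(2)[OF r, of "\<lambda>i. Rep_unit_interval (c i)"] by blast
    then show "\<exists>x\<in>apply_bcontfun (f + wave_bcontfun) -` {y}. \<forall>i. r i < dist x (c i)"
      by (intro bexI[of _ "Abs_unit_interval x"])
        (auto simp: sum_eq dist_unit_interval Abs_unit_interval_inverse simp del: plus_bcontfun.rep_eq)
  qed
qed

end

theorem theorem6p1:
  "\<not> shy {f :: C01. \<forall>y\<in>{min_val f<..<max_val f}. hausdorff_dim (apply_bcontfun f -` {y}) = 1}"
  (is "\<not> shy ?A")
proof
  assume "shy ?A"
  then obtain B and \<nu> :: "C01 measure" where B: "B \<in> sets borel" "?A \<subseteq> B"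
    and \<nu>: "prob_space \<nu>" "sets \<nu> = sets borel"
    and null: "\<And>x. emeasure \<nu> ((\<lambda>b. b + x) ` B) = 0"
    unfolding shy_def by blast
  obtain m where m: "\<And>n. 0 < m n" "equicontinuous_set m \<in> sets \<nu>"
      "emeasure \<nu> (equicontinuous_set m) \<noteq> 0"
    using equicontinuous_set_positive_measure[OF \<nu>] by blast
  obtain l where l: "wave_scales l" "\<And>n. l n \<le> m n"
    using ex_wave_scales_le[of m] m(1) by blast
  interpret wave_scales l by fact
  let ?g = wave_bcontfun
  have "equicontinuous_set m \<subseteq> (\<lambda>b. b + - ?g) ` B"
  proof
    fix f assume "f \<in> equicontinuous_set m"
    then have "f + ?g \<in> B" using hausdorff_dim_level_set[OF _ l(2)] B(2) by blast
    then show "f \<in> (\<lambda>b. b + - ?g) ` B" by (rule rev_image_eqI) simp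
  qed
  \<comment> \<open>Monotonicity of \<open>emeasure\<close> requires the larger set to be
    measurable; a translate is the preimage under the opposite translation, which is
    continuous.\<close>
  moreover have "(\<lambda>b. b + - ?g) ` B \<in> sets \<nu>"
  proof -
    have "(\<lambda>b. b + - ?g) ` B = (\<lambda>b. b + ?g) -` B \<inter> space borel"
      by (force simp: image_iff)
    also have "\<dots> \<in> sets borel"
      using B(1) by (intro measurable_sets[OF borel_measurable_continuous_onI] continuous_intros)
    finally show ?thesis using \<nu>(2) by simp
  qed
  ultimately have "emeasure \<nu> (equicontinuous_set m) \<le> 0"
    using null[of "- ?g"] emeasure_mono by metis
  then show False using m(3) by simp
qed

end
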